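(* Let $k,d,t\in\mathbb N_+$ with $k\ge4$, $2\le t\le k-2$, $2t\le d+1$, and set $n=k+d$. Decompose $n-(k-1)=ct+r$ with $c,r\in\mathbb N$ such that $0\le r<t$. Then $c\ge2$, and for $g=(k,1^{[d]})$ and $m=(k-1,t^{[c]},r)$ we have: $g\in\mathcal J(\mathcal L_n)$ is of type C, $m\in\mathcal M(\mathcal L_n)$ is of type IV, and $g\swarrow m$ holds but $g\nearrow m$ does not hold.
   Context: $\mathbb N=\{0,1,2,\dots\}$, $\mathbb N_+=\mathbb N\setminus\{0\}$. A partition of $n\in\mathbb N$ is a tuple $(a_1,\dots,a_n)$ of natural numbers with $a_1\ge\dots\ge a_n\ge 0$ and $\sum a_i=n$; trailing zeros may be omitted or added. $x^{[s]}$ denotes $s$ consecutive entries equal to $x$ (no entry if $s=0$). $\mathcal L_n$ is the finite lattice of all partitions of $n$ under the dominance order: $a\le b$ iff $\sum_{i=1}^j a_i\le\sum_{i=1}^j b_i$ for all $1\le j\le n$. $\mathcal J(\mathcal L_n)$ is the set of (completely) join-irreducible elements (not the least element, and $x=y\vee z$ implies $x=y$ or $x=z$); $\mathcal M(\mathcal L_n)$ is the set of (completely) meet-irreducible elements (not the greatest element, and $x=y\wedge z$ implies $x=y$ or $x=z$). Arrow relations of the standard context $(\mathcal J(\mathcal L_n),\mathcal M(\mathcal L_n),\le)$: for $g\in\mathcal J(\mathcal L_n)$ and $m\in\mathcal M(\mathcal L_n)$ put $g'=\{y\in\mathcal M(\mathcal L_n): g\le y\}$ and $m'=\{y\in\mathcal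 J(\mathcal L_n): y\le m\}$. Then $g\swarrow m$ iff $g\nleq m$ and for all $h\in\mathcal J(\mathcal L_n)$ with $g'\subsetneq h'$ we have $h\le m$; and $g\nearrow m$ iff $g\nleq m$ and for all $y\in\mathcal M(\mathcal L_n)$ with $m'\subsetneq y'$ we have $g\le y$. Types of partitions of $n$: type C (in $\mathcal J(\mathcal L_n)$): $(k,1^{[d]})$ with $k\ge3$, $d\ge1$; type IV (in $\mathcal M(\mathcal L_n)$): $(a,t^{[c]},r)$ with $a>t>r\ge0$ and $t,c\ge2$. *)

theory Defs
  imports "HOL-Algebra.Lattice"
begin

text \<open>
  A partition of \<open>n\<close> is represented by its unique form with exactly \<open>n\<close> entries,
  i.e. all trailing zeros are written out.
\<close>

definition partitions_of :: "nat \<Rightarrow> nat list set" where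
  "partitions_of n = {a. length a = n \<and> sorted_wrt (\<ge>) a \<and> sum_list a = n}"

definition dominates :: "nat \<Rightarrow> nat list \<Rightarrow> nat list \<Rightarrow> bool" where
  "dominates n b a \<longleftrightarrow> (\<forall>j\<in>{1..n}. sum_list (take j a) \<le> sum_list (take j b))"

definition partition_lattice :: "nat \<Rightarrow> nat list gorder" where
  "partition_lattice n =
     \<lparr> carrier = partitions_of n, eq = (=), le = (\<lambda>a b. dominates n b a) \<rparr>"

text \<open>
  Restores omitted trailing zeros.  Lists longer than \<open>n\<close> are left unchanged,
  hence are not partitions of \<open>n\<close>.
\<close>

definition pad_zeros :: "nat \<Rightarrow> nat list \<Rightarrow> nat list" where
  "pad_zeros n a = a @ replicate (n - length a) 0"

text \<open>
  The following notions are meant for (finite) lattices \<open>L\<close> whose equality \<open>eq L\<close> is \<open>(=)\<close>.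
  In a finite lattice, irreducibility with respect to binary joins (meets) is the same as
  complete irreducibility.
\<close>

definition join_irreducibles :: "('a, 'b) gorder_scheme \<Rightarrow> 'a set" where
  "join_irreducibles L =
     {x \<in> carrier L. \<not> least L x (carrier L) \<and>
        (\<forall>y\<in>carrier L. \<forall>z\<in>carrier L. x = y \<squnion>\<^bsub>L\<^esub> z \<longrightarrow> x = y \<or> x = z)}"

definition meet_irreducibles :: "('a, 'b) gorder_scheme \<Rightarrow> 'a set" where
  "meet_irreducibles L =
     {x \<in> carrier L. \<not> greatest L x (carrier L) \<and>
        (\<forall>y\<in>carrier L. \<forall>z\<in>carrier L. x = y \<sqinter>\<^bsub>L\<^esub> z \<longrightarrow> x = y \<or> x = z)}"

text \<open>The derivations \<open>g'\<close> and \<open>m'\<close> in the standard context of \<open>L\<close>.\<close>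

definition object_intent :: "('a, 'b) gorder_scheme \<Rightarrow> 'a \<Rightarrow> 'a set" where
  "object_intent L g = {y \<in> meet_irreducibles L. g \<sqsubseteq>\<^bsub>L\<^esub> y}"

definition attribute_extent :: "('a, 'b) gorder_scheme \<Rightarrow> 'a \<Rightarrow> 'a set" where
  "attribute_extent L m = {y \<in> join_irreducibles L. y \<sqsubseteq>\<^bsub>L\<^esub> m}"

text \<open>
  The arrow relations \<open>g \<swarrow> m\<close> and \<open>g \<nearrow> m\<close>, intended for join-irreducible \<open>g\<close> and
  meet-irreducible \<open>m\<close>.
\<close>

definition down_arrow :: "('a, 'b) gorder_scheme \<Rightarrow> 'a \<Rightarrow> 'a \<Rightarrow> bool" where
  "down_arrow L g m \<longleftrightarrow> \<not> g \<sqsubseteq>\<^bsub>L\<^esub> m \<and>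
     (\<forall>h\<in>join_irreducibles L. object_intent L g \<subset> object_intent L h \<longrightarrow> h \<sqsubseteq>\<^bsub>L\<^esub> m)"

definition up_arrow :: "('a, 'b) gorder_scheme \<Rightarrow> 'a \<Rightarrow> 'a \<Rightarrow> bool" where
  "up_arrow L g m \<longleftrightarrow> \<not> g \<sqsubseteq>\<^bsub>L\<^esub> m \<and>
     (\<forall>y\<in>meet_irreducibles L. attribute_extent L m \<subset> attribute_extent L y \<longrightarrow> g \<sqsubseteq>\<^bsub>L\<^esub> y)"

definition type_C :: "nat \<Rightarrow> nat list \<Rightarrow> bool" where
  "type_C n x \<longleftrightarrow> x \<in> partitions_of n \<and>
     (\<exists>k d. 3 \<le> k \<and> 1 \<le> d \<and> x = pad_zeros n (k # replicate d 1))"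

definition type_IV :: "nat \<Rightarrow> nat list \<Rightarrow> bool" where
  "type_IV n x \<longleftrightarrow> x \<in> partitions_of n \<and>
     (\<exists>a t c r. t < a \<and> r < t \<and> 2 \<le> t \<and> 2 \<le> c \<and> x = pad_zeros n (a # replicate c t @ [r]))"

end

theory Submission
  imports Defs
begin

text \<open>
  A partition is encoded by its sequence of partial sums, which is concave, and dominance is the
  pointwise order of these sequences; pointwise minima therefore provide all infima.
  The partial sums of \<open>g\<close> and \<open>m\<close> are \<open>min (k + j) n\<close> and \<open>min (k - 1 + j t) n\<close> at \<open>j + 1\<close>.
  A partition strictly below \<open>g\<close> has first part less than \<open>k\<close>, so it lies below \<open>m\<close> because
  \<open>t \<ge> 2\<close>; this gives \<open>g \<swarrow> m\<close>.  Raising the partial sums of \<open>m\<close> by one at the positions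
  \<open>2, \<dots>, c\<close> gives its unique upper cover \<open>p\<close>: the excess of a partition above \<open>m\<close> is concave
  where \<open>m\<close> is linear, so if it vanishes at one of these positions it vanishes everywhere.
  The first part of \<open>p\<close> is still \<open>k - 1\<close>, so \<open>g \<le> p\<close> fails, and a meet-irreducible above \<open>p\<close>
  but not above \<open>g\<close> refutes \<open>g \<nearrow> m\<close>.
\<close>

section \<open>Irreducibles and arrows in finite lattices\<close>

lemma join_irreducibles_eq_dual:
  "join_irreducibles L = meet_irreducibles (inv_gorder L)"
  unfolding join_irreducibles_def meet_irreducibles_def by simp

lemma meet_irreducibles_eq_dual:
  "meet_irreducibles L = join_irreducibles (inv_gorder L)"
  unfolding join_irreducibles_def meet_irreducibles_def by simp

context Lattice.lattice
begin

text \<open>Two elements strictly below \<open>x\<close> both lie below \<open>p\<close>, hence so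
  does their join, which therefore differs from \<open>x\<close>. In the application
  \<open>p\<close> is the unique lower cover of \<open>x\<close>.\<close>

lemma join_irreducibleI:
  assumes x: "x \<in> carrier L" and p: "p \<in> carrier L" "\<not> x \<sqsubseteq> p"
    and below: "\<And>y. y \<in> carrier L \<Longrightarrow> y \<sqsubseteq> x \<Longrightarrow> y \<noteq> x \<Longrightarrow> y \<sqsubseteq> p"
  shows "x \<in> join_irreducibles L"
proof -
  have "x = y \<or> x = z" if yz: "y \<in> carrier L" "z \<in> carrier L" and "x = y \<squnion> z" for y z
  proof (rule ccontr)
    assume "\<not> ?thesis"
    then have "y \<sqsubseteq> p" "z \<sqsubseteq> p"
      using below join_left[OF yz] join_right[OF yz] yz \<open>x = y \<squnion> z\<close> by metis+
    then show False
      using join_le[OF _ _ yz p(1)] p(2) \<open>x = y \<squnion> z\<close> by simp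
  qed
  moreover have "\<not> least L x (carrier L)"
    using p by (auto simp: least_def)
  ultimately show ?thesis
    using x by (auto simp: join_irreducibles_def)
qed

lemma meet_irreducibleI:
  assumes "x \<in> carrier L" and "p \<in> carrier L" "\<not> p \<sqsubseteq> x"
    and "\<And>y. y \<in> carrier L \<Longrightarrow> x \<sqsubseteq> y \<Longrightarrow> y \<noteq> x \<Longrightarrow> p \<sqsubseteq> y"
  shows "x \<in> meet_irreducibles L"
proof -
  interpret dual: Lattice.lattice "inv_gorder L" by (rule dual_lattice)
  show ?thesis
    unfolding meet_irreducibles_eq_dual
    by (rule dual.join_irreducibleI[of x p]) (use assms in auto)
qed

text \<open>An element maximal among those above \<open>g\<close> but not above \<open>h\<close> is
  meet-irreducible: if it were the meet of two strictly larger elements, maximality would put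
  \<open>h\<close> below both, hence below their meet.\<close>

lemma meet_irreducibles_dense:
  assumes fin: "finite (carrier L)" and gh: "g \<in> carrier L" "h \<in> carrier L" and nle: "\<not> h \<sqsubseteq> g"
  obtains y where "y \<in> meet_irreducibles L" "g \<sqsubseteq> y" "\<not> h \<sqsubseteq> y"
proof -
  let ?A = "{y \<in> carrier L. g \<sqsubseteq> y \<and> \<not> h \<sqsubseteq> y}"
  let ?R = "\<lambda>x y. x \<sqsubseteq> y \<and> x \<noteq> y"
  have "\<exists>y\<in>?A. \<forall>x\<in>?A. x \<noteq> y \<longrightarrow> \<not> ?R y x"
  proof (rule Finite_Set.bex_max_element)
    show "finite ?A" using fin by simp
    show "asymp_on ?A ?R"
      by (auto simp: asymp_on_def intro: le_antisym)
    show "transp_on ?A ?R"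
      by (rule transp_onI) (auto intro: le_trans dest: le_antisym)
    show "?A \<noteq> {}" using gh nle by auto
  qed
  then obtain y where yA: "y \<in> ?A" and yR: "\<forall>x\<in>?A. x \<noteq> y \<longrightarrow> \<not> ?R y x"
    by (rule bexE)
  have y: "y \<in> carrier L" "g \<sqsubseteq> y" "\<not> h \<sqsubseteq> y" using yA by simp_all
  have above: "h \<sqsubseteq> u" if "u \<in> carrier L" "y \<sqsubseteq> u" "u \<noteq> y" for u
    using yR le_trans[OF y(2) that(2)] that y(1) gh(1) by auto
  have "y = u \<or> y = v" if uv: "u \<in> carrier L" "v \<in> carrier L" and "y = u \<sqinter> v" for u v
  proof (rule ccontr)
    assume "\<not> ?thesis"
    then have "h \<sqsubseteq> u" "h \<sqsubseteq> v"
      using above meet_left[OF uv] meet_right[OF uv] uv \<open>y = u \<sqinter> v\<close> by metis+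
    then show False
      using meet_le[OF _ _ uv gh(2)] y(3) \<open>y = u \<sqinter> v\<close> by simp
  qed
  moreover have "\<not> greatest L y (carrier L)"
    using y(3) gh(2) by (auto simp: greatest_def)
  ultimately have "y \<in> meet_irreducibles L"
    using y(1) by (auto simp: meet_irreducibles_def)
  with y that show ?thesis by blast
qed

lemma join_irreducibles_dense:
  assumes "finite (carrier L)" "g \<in> carrier L" "h \<in> carrier L" "\<not> h \<sqsubseteq> g"
  obtains y where "y \<in> join_irreducibles L" "y \<sqsubseteq> h" "\<not> y \<sqsubseteq> g"
proof -
  interpret dual: Lattice.lattice "inv_gorder L" by (rule dual_lattice)
  show ?thesis
    using dual.meet_irreducibles_dense[of h g] assms that
    by (auto simp: join_irreducibles_eq_dual)
qed

text \<open>By density, inclusion of intents forces \<open>h\<close> below \<open>g\<close>, and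
  strictness of the inclusion excludes \<open>h = g\<close>. So it suffices to place everything
  strictly below \<open>g\<close> under \<open>m\<close>.\<close>

lemma down_arrowI:
  assumes fin: "finite (carrier L)" and g: "g \<in> carrier L" and nle: "\<not> g \<sqsubseteq> m"
    and below: "\<And>h. h \<in> carrier L \<Longrightarrow> h \<sqsubseteq> g \<Longrightarrow> h \<noteq> g \<Longrightarrow> h \<sqsubseteq> m"
  shows "down_arrow L g m"
  unfolding down_arrow_def
proof (intro conjI ballI impI nle)
  fix h
  assume "h \<in> join_irreducibles L" and sub: "object_intent L g \<subset> object_intent L h"
  then have h: "h \<in> carrier L" by (simp add: join_irreducibles_def)
  have "h \<sqsubseteq> g"
  proof (rule ccontr)
    assume "\<not> h \<sqsubseteq> g"
    then obtain y where "y \<in> meet_irreducibles L" "g \<sqsubseteq> y" "\<not> h \<sqsubseteq> y"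
      using meet_irreducibles_dense[OF fin g h] by blast
    with sub show False by (auto simp: object_intent_def)
  qed
  with sub below h show "h \<sqsubseteq> m" by auto
qed

text \<open>The refuting attribute is a meet-irreducible \<open>y\<close> above \<open>p\<close> but
  not above \<open>g\<close>. Its extent is strictly larger than that of \<open>m\<close>: a
  join-irreducible below \<open>p\<close> but not below \<open>m\<close> belongs to it.\<close>

lemma not_up_arrowI:
  assumes fin: "finite (carrier L)" and carr: "g \<in> carrier L" "m \<in> carrier L" "p \<in> carrier L"
    and p: "m \<sqsubseteq> p" "\<not> p \<sqsubseteq> m" "\<not> g \<sqsubseteq> p"
  shows "\<not> up_arrow L g m"
proof -
  obtain y where y: "y \<in> meet_irreducibles L" "p \<sqsubseteq> y" "\<not> g \<sqsubseteq> y"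
    using meet_irreducibles_dense[OF fin carr(3,1) p(3)] by blast
  then have yc: "y \<in> carrier L" by (simp add: meet_irreducibles_def)
  obtain h where h: "h \<in> join_irreducibles L" "h \<sqsubseteq> p" "\<not> h \<sqsubseteq> m"
    using join_irreducibles_dense[OF fin carr(2,3) p(2)] by blast
  have J: "x \<in> carrier L" if "x \<in> join_irreducibles L" for x
    using that by (simp add: join_irreducibles_def)
  have "m \<sqsubseteq> y" using le_trans[OF p(1) y(2)] carr yc by simp
  then have "attribute_extent L m \<subseteq> attribute_extent L y"
    using le_trans[OF _ _ _ carr(2) yc] J by (auto simp: attribute_extent_def)
  moreover have "h \<in> attribute_extent L y" "h \<notin> attribute_extent L m"
    using h le_trans[OF h(2) y(2) J[OF h(1)] carr(3) yc] by (auto simp: attribute_extent_def)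
  ultimately have "attribute_extent L m \<subset> attribute_extent L y" by blast
  with y show ?thesis by (auto simp: up_arrow_def)
qed

end

section \<open>Partitions and their partial sums\<close>

text \<open>\<open>take\<close> stops at the end of the list, so the sequence is eventually constant
  and inequalities can be stated for all \<open>j\<close>.\<close>

definition partial_sum :: "nat list \<Rightarrow> nat \<Rightarrow> nat" where
  "partial_sum a j = sum_list (take j a)"

lemma partial_sum_0 [simp]: "partial_sum a 0 = 0"
  by (simp add: partial_sum_def)

lemma partial_sum_Suc:
  "partial_sum a (Suc j) = partial_sum a j + (if j < length a then a ! j else 0)"
  by (simp add: partial_sum_def take_Suc_conv_app_nth)

lemma partial_sum_mono: "i \<le> j \<Longrightarrow> partial_sum a i \<le> partial_sum a j"
  by (rule lift_Suc_mono_le[of "partial_sum a"]) (simp_all add: partial_sum_Suc)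

lemma partial_sum_all: "a \<in> partitions_of n \<Longrightarrow> n \<le> j \<Longrightarrow> partial_sum a j = n"
  by (simp add: partial_sum_def partitions_of_def)

lemma partial_sum_le: "a \<in> partitions_of n \<Longrightarrow> partial_sum a j \<le> n"
  by (metis le_cases partial_sum_all partial_sum_mono order_refl)

text \<open>The second difference at \<open>i\<close> is \<open>a ! Suc i - a ! i\<close> (parts
  past the end count as 0), nonpositive because the parts decrease. The additive form avoids
  truncated subtraction.\<close>

lemma partial_sum_concave:
  assumes "a \<in> partitions_of n"
  shows "partial_sum a i + partial_sum a (Suc (Suc i)) \<le> 2 * partial_sum a (Suc i)"
proof -
  have "a ! Suc i \<le> a ! i" if "Suc i < length a"
    using assms that by (auto simp: partitions_of_def sorted_wrt_iff_nth_less)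
  then show ?thesis by (auto simp: partial_sum_Suc)
qed

text \<open>By concavity, once an increment is zero all later ones are, so the sum has already
  reached its final value.\<close>

lemma partial_sum_stationary:
  assumes a: "a \<in> partitions_of n" and eq: "partial_sum a (Suc j) = partial_sum a j"
  shows "partial_sum a j = n"
proof -
  have "partial_sum a (Suc (j + i)) = partial_sum a (j + i)" for i
  proof (induction i)
    case 0
    then show ?case using eq by simp
  next
    case (Suc i)
    then show ?case
      using partial_sum_concave[OF a, of "j + i"]
        partial_sum_mono[of "Suc (j + i)" "Suc (Suc (j + i))" a] by simp
  qed
  then have "partial_sum a (j + i) = partial_sum a j" for i
    by (induction i) simp_all
  from this[of n] show ?thesis using partial_sum_all[OF a, of "j + n"] by simp
qed

lemma partition_eqI:
  assumes a: "a \<in> partitions_of n" and b: "b \<in> partitions_of n"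
    and eq: "\<And>j. partial_sum a j = partial_sum b j"
  shows "a = b"
proof (rule nth_equalityI)
  show len: "length a = length b"
    using a b by (simp add: partitions_of_def)
  show "a ! i = b ! i" if "i < length a" for i
    using eq[of i] eq[of "Suc i"] that len by (simp add: partial_sum_Suc)
qed

text \<open>The increments of \<open>S\<close> serve as parts: monotonicity makes the natural
  subtraction exact, concavity sorts them, and stabilization at index \<open>n\<close> makes
  \<open>n\<close> entries enough.\<close>

lemma partition_with_partial_sums:
  fixes S :: "nat \<Rightarrow> nat"
  assumes zero: "S 0 = 0" and mono: "\<And>i. S i \<le> S (Suc i)"
    and all: "\<And>j. n \<le> j \<Longrightarrow> S j = n"
    and concave: "\<And>i. S i + S (Suc (Suc i)) \<le> 2 * S (Suc i)"
  obtains a where "a \<in> partitions_of n" "\<And>j. partial_sum a j = S j"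
proof -
  let ?a = "map (\<lambda>i. S (Suc i) - S i) [0..<n]"
  have sums: "partial_sum ?a j = S j" for j
  proof (induction j)
    case 0
    then show ?case by (simp add: zero)
  next
    case (Suc j)
    then show ?case using mono[of j] all[of j] all[of "Suc j"]
      by (auto simp: partial_sum_Suc)
  qed
  have "S (Suc (Suc i)) - S (Suc i) \<le> S (Suc i) - S i" for i
    using concave[of i] mono[of i] mono[of "Suc i"] by linarith
  then have "S (Suc j) - S j \<le> S (Suc i) - S i" if "i \<le> j" for i j
    using lift_Suc_antimono_le[of "\<lambda>i. S (Suc i) - S i", OF _ that] by simp
  then have "sorted_wrt (\<ge>) ?a"
    by (auto simp: sorted_wrt_iff_nth_less)
  moreover have "sum_list ?a = n"
    using sums[of n] all[of n] by (simp add: partial_sum_def)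
  ultimately have "?a \<in> partitions_of n"
    by (simp add: partitions_of_def)
  with sums that show ?thesis by blast
qed

text \<open>A pointwise minimum of concave functions is concave.\<close>

lemma partition_inf:
  assumes A: "A \<subseteq> partitions_of n" "A \<noteq> {}"
  obtains a where "a \<in> partitions_of n" "\<And>j. partial_sum a j = (INF b\<in>A. partial_sum b j)"
proof -
  define S where "S j = (INF b\<in>A. partial_sum b j)" for j
  have attained: "\<exists>b\<in>A. S j = partial_sum b j" for j
    using Inf_nat_def1[of "(\<lambda>b. partial_sum b j) ` A"] A(2) by (auto simp: S_def)
  have lower: "S j \<le> partial_sum b j" if "b \<in> A" for b j
    unfolding S_def using that by (intro cINF_lower) auto
  show ?thesis
  proof (rule partition_with_partial_sums[of S n])
    show "S 0 = 0" using attained[of 0] by auto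
    show "S i \<le> S (Suc i)" for i
      using attained[of "Suc i"] lower[of _ i] partial_sum_mono[of i "Suc i"]
      by (metis le_SucI order_refl order_trans)
    show "S j = n" if "n \<le> j" for j
      using attained[of j] A(1) that partial_sum_all by blast
    show "S i + S (Suc (Suc i)) \<le> 2 * S (Suc i)" for i
    proof -
      \<comment> \<open>One \<open>b\<close> attains the minimum at the middle index. Its concavity
        suffices, since the minima at the two outer indices are at most the values of
        \<open>b\<close> there.\<close>
      obtain b where b: "b \<in> A" "S (Suc i) = partial_sum b (Suc i)"
        using attained by blast
      then show ?thesis
        using lower[OF b(1), of i] lower[OF b(1), of "Suc (Suc i)"]
          partial_sum_concave[of b n i] A(1) by auto
    qed
  qed (use that S_def in auto)
qed

section \<open>Finiteness and lattice structure of the dominance order\<close>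

lemma finite_partitions_of: "finite (partitions_of n)"
proof (rule finite_subset)
  show "partitions_of n \<subseteq> {a. set a \<subseteq> {..n} \<and> length a = n}"
    using member_le_sum_list by (fastforce simp: partitions_of_def)
  show "finite {a. set a \<subseteq> {..n} \<and> length a = n}"
    by (rule finite_lists_length_eq) simp
qed

lemma carrier_partition_lattice [simp]: "carrier (partition_lattice n) = partitions_of n"
  by (simp add: partition_lattice_def)

text \<open>At index 0 all partial sums are 0 and from \<open>n\<close> on they are
  \<open>n\<close>, so the bounded range in \<open>dominates\<close> extends to all indices.\<close>

lemma le_partition_lattice:
  assumes "a \<in> partitions_of n" "b \<in> partitions_of n"
  shows "a \<sqsubseteq>\<^bsub>partition_lattice n\<^esub> b \<longleftrightarrow> (\<forall>j. partial_sum a j \<le> partial_sum b j)"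
proof -
  have "partial_sum a j \<le> partial_sum b j"
    if "\<forall>j\<in>{1..n}. partial_sum a j \<le> partial_sum b j" for j
    using that assms by (cases "j = 0 \<or> n \<le> j") (auto simp: partial_sum_all)
  then show ?thesis
    by (auto simp: partition_lattice_def dominates_def partial_sum_def)
qed

lemma partition_glb_exists:
  assumes "A \<subseteq> partitions_of n" "A \<noteq> {}"
  shows "\<exists>a. greatest (partition_lattice n) a (Lower (partition_lattice n) A)"
proof -
  obtain a where a: "a \<in> partitions_of n" "\<And>j. partial_sum a j = (INF b\<in>A. partial_sum b j)"
    using partition_inf[OF assms] by blast
  have "greatest (partition_lattice n) a (Lower (partition_lattice n) A)"
  proof (rule greatest_LowerI)
    show "a \<sqsubseteq>\<^bsub>partition_lattice n\<^esub> x" if "x \<in> A" for x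
      using that assms(1) a by (subst le_partition_lattice) (auto intro: cINF_lower)
    fix y
    assume y: "y \<in> Lower (partition_lattice n) A"
    then have yn: "y \<in> partitions_of n" by (auto simp: Lower_def)
    have "partial_sum y j \<le> partial_sum b j" if "b \<in> A" for b j
      using Lower_memD[OF y that] assms(1) that yn
      by (auto simp: le_partition_lattice subset_eq)
    then show "y \<sqsubseteq>\<^bsub>partition_lattice n\<^esub> a"
      using yn a assms(2) by (subst le_partition_lattice) (auto intro: cINF_greatest)
  qed (use assms a in auto)
  then show ?thesis by blast
qed

lemma partition_top_exists:
  obtains a where "a \<in> partitions_of n" "\<And>j. 0 < j \<Longrightarrow> partial_sum a j = n"
proof -
  obtain a where "a \<in> partitions_of n" "\<And>j. partial_sum a j = (if j = 0 then 0 else n)"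
    by (rule partition_with_partial_sums[of "\<lambda>j. if j = 0 then 0 else n" n]) auto
  with that show ?thesis by simp
qed

text \<open>Meets are pointwise minima. A pointwise maximum of concave sequences need not be
  concave, so a join is obtained as the infimum of all upper bounds, a set that contains the top
  element \<open>u\<close>.\<close>

lemma lattice_partition_lattice: "Lattice.lattice (partition_lattice n)"
proof -
  let ?L = "partition_lattice n"
  interpret partial_order ?L
  proof unfold_locales
    show "(.=\<^bsub>?L\<^esub>) = (=)" by (simp add: partition_lattice_def)
    show "x .=\<^bsub>?L\<^esub> y" if "x \<sqsubseteq>\<^bsub>?L\<^esub> y" "y \<sqsubseteq>\<^bsub>?L\<^esub> x" "x \<in> carrier ?L" "y \<in> carrier ?L" for x y
    proof -
      have "x = y"
        using that by (intro partition_eqI[of x n y]) (auto simp: le_partition_lattice intro: antisym)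
      then show ?thesis by (simp add: partition_lattice_def)
    qed
    show "x \<sqsubseteq>\<^bsub>?L\<^esub> z"
      if "x \<sqsubseteq>\<^bsub>?L\<^esub> y" "y \<sqsubseteq>\<^bsub>?L\<^esub> z" "x \<in> carrier ?L" "y \<in> carrier ?L" "z \<in> carrier ?L" for x y z
      using that by (auto simp: le_partition_lattice intro: order_trans)
  qed (auto simp: partition_lattice_def dominates_def)
  obtain u where u: "u \<in> partitions_of n" "\<And>j. 0 < j \<Longrightarrow> partial_sum u j = n"
    using partition_top_exists by blast
  have top: "x \<sqsubseteq>\<^bsub>?L\<^esub> u" if "x \<in> carrier ?L" for x
  proof -
    have "partial_sum x j \<le> partial_sum u j" for j
      using that partial_sum_le[of x n j] u(2)[of j] by (cases "j = 0") auto
    then show ?thesis using that u(1) by (simp add: le_partition_lattice)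
  qed
  show ?thesis
  proof unfold_locales
    fix x y
    assume xy: "x \<in> carrier ?L" "y \<in> carrier ?L"
    show "\<exists>s. greatest ?L s (Lower ?L {x, y})"
      using xy by (intro partition_glb_exists) auto
    let ?U = "Upper ?L {x, y}"
    have U: "?U \<subseteq> carrier ?L" by (auto simp: Upper_def)
    have "u \<in> ?U"
      using xy top u(1) by (auto intro!: Upper_memI)
    then obtain s where s: "greatest ?L s (Lower ?L ?U)"
      using partition_glb_exists[of ?U n] U by auto
    have "least ?L s ?U"
    proof (rule least_UpperI)
      show "z \<sqsubseteq>\<^bsub>?L\<^esub> s" if "z \<in> {x, y}" for z
        using that xy by (intro greatest_le[OF s] Lower_memI) (auto simp: Upper_def)
      show "s \<sqsubseteq>\<^bsub>?L\<^esub> z" if "z \<in> ?U" for z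
        using greatest_Lower_below[OF s that U] .
    qed (use xy greatest_closed[OF s] in simp_all)
    then show "\<exists>s. least ?L s ?U" by blast
  qed
qed

text \<open>At an interior zero, concavity bounds the sum of the two neighbouring values by 0, so
  both vanish; the zero then spreads in either direction to the ends \<open>p\<close> and
  \<open>q\<close>.\<close>

lemma concave_nonneg_interior_zero:
  fixes D :: "nat \<Rightarrow> int"
  assumes nonneg: "\<And>i. 0 \<le> D i"
    and concave: "\<And>i. p \<le> i \<Longrightarrow> i + 2 \<le> q \<Longrightarrow> D i + D (i + 2) \<le> 2 * D (i + 1)"
    and j: "p < j" "j < q" "D j = 0" and i: "p \<le> i" "i \<le> q"
  shows "D i = 0"
proof -
  have nbr: "D i = 0 \<and> D (i + 2) = 0" if "D (i + 1) = 0" "p \<le> i" "i + 2 \<le> q" for i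
    using concave[of i] that nonneg[of i] nonneg[of "i + 2"] by simp
  show ?thesis
  proof (cases "j \<le> i")
    case True
    from True i(2) show ?thesis
    proof (induction i rule: dec_induct)
      case base
      show ?case by (fact j(3))
    next
      case (step i)
      then show ?case using nbr[of "i - 1"] j(1) by simp
    qed
  next
    case False
    then have "i \<le> j" by simp
    from this i(1) show ?thesis
    proof (induction i rule: inc_induct)
      case base
      show ?case by (fact j(3))
    next
      case (step i)
      then show ?case using nbr[of i] j(2) by simp
    qed
  qed
qed

section \<open>Hooks and partitions of type IV\<close>

lemma sorted_wrt_ge_replicate: "sorted_wrt (\<ge>) (replicate k (x :: nat))"
  by (simp add: sorted_wrt_iff_nth_less)

lemma hook_in_partitions_of:
  assumes "1 \<le> k" "n = k + d"
  shows "pad_zeros n (k # replicate d 1) \<in> partitions_of n"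
  using assms
  by (auto simp: pad_zeros_def partitions_of_def sorted_wrt_append sorted_wrt_ge_replicate
      sum_list_replicate)

lemma partial_sum_hook:
  assumes "1 \<le> k" "n = k + d"
  shows "partial_sum (pad_zeros n (k # replicate d 1)) (Suc j) = min (k + j) n"
  using assms by (simp add: pad_zeros_def partial_sum_def sum_list_replicate min_def)

text \<open>If the first part were at least \<open>k\<close>, each further partial sum would grow by
  at least one until it reaches \<open>n\<close>. Then \<open>y\<close> would dominate the hook and
  hence equal it.\<close>

lemma strictly_below_hook:
  assumes kn: "1 \<le> k" "n = k + d" and g: "g = pad_zeros n (k # replicate d 1)"
    and y: "y \<in> partitions_of n" and le: "\<And>j. partial_sum y j \<le> partial_sum g j" and ne: "y \<noteq> g"
  shows "partial_sum y 1 < k"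
proof (rule ccontr)
  note sum_g = partial_sum_hook[OF kn, folded g]
  assume "\<not> ?thesis"
  have "min (k + j) n \<le> partial_sum y (Suc j)" for j
  proof (induction j)
    case 0
    then show ?case using \<open>\<not> partial_sum y 1 < k\<close> by simp
  next
    case (Suc j)
    show ?case
    proof (cases "partial_sum y (Suc (Suc j)) = partial_sum y (Suc j)")
      case True
      then show ?thesis using partial_sum_stationary[OF y True] by simp
    next
      case False
      then show ?thesis
        using Suc partial_sum_mono[of "Suc j" "Suc (Suc j)" y] by simp
    qed
  qed
  then have "partial_sum y j = partial_sum g j" for j
    using le[of j] by (cases j) (auto simp: sum_g intro: antisym)
  then show False
    using partition_eqI[OF y] hook_in_partitions_of[OF kn] ne g by blast
qed

text \<open>The witness \<open>p\<close> in the proof is the unique lower cover \<open>(k - 1, 2, 1\<^sup>d\<^sup>-\<^sup>1)\<close>.\<close>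

lemma hook_join_irreducible:
  assumes k: "3 \<le> k" and d: "1 \<le> d" and n: "n = k + d" and g: "g = pad_zeros n (k # replicate d 1)"
  shows "g \<in> join_irreducibles (partition_lattice n)"
proof -
  interpret L: Lattice.lattice "partition_lattice n" by (rule lattice_partition_lattice)
  have k1: "1 \<le> k" using k by simp
  note sum_g = partial_sum_hook[OF k1 n, folded g]
  have gn: "g \<in> partitions_of n" using hook_in_partitions_of[OF k1 n] g by simp
  define S where "S j = partial_sum g j - of_bool (j = 1)" for j
  obtain p where p: "p \<in> partitions_of n" "\<And>j. partial_sum p j = S j"
  proof (rule partition_with_partial_sums[of S n])
    show "S 0 = 0" by (simp add: S_def)
    show "S i \<le> S (Suc i)" for i
      using partial_sum_mono[of i "Suc i" g] by (cases i) (auto simp: S_def)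
    show "S j = n" if "n \<le> j" for j
      using partial_sum_all[OF gn that] that n d k by (simp add: S_def)
    show "S i + S (Suc (Suc i)) \<le> 2 * S (Suc i)" for i
    proof (cases i)
      \<comment> \<open>Concavity is at risk only around the lowered index 1, where it reads
        \<open>k + 1 \<le> 2 * (k - 1)\<close>, that is, \<open>3 \<le> k\<close>.\<close>
      case 0
      then show ?thesis using k n d by (simp add: S_def sum_g)
    next
      case (Suc l)
      then show ?thesis using partial_sum_concave[OF gn, of i] by (simp add: S_def)
    qed
  qed blast
  show ?thesis
  proof (rule L.join_irreducibleI[of g p])
    show "\<not> g \<sqsubseteq>\<^bsub>partition_lattice n\<^esub> p"
      using p gn k n sum_g[of 0] by (auto simp: le_partition_lattice S_def intro!: exI[of _ 1])
    show "y \<sqsubseteq>\<^bsub>partition_lattice n\<^esub> p"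
      if y: "y \<in> carrier (partition_lattice n)" "y \<sqsubseteq>\<^bsub>partition_lattice n\<^esub> g" "y \<noteq> g" for y
    proof -
      have le: "\<And>j. partial_sum y j \<le> partial_sum g j"
        using y gn by (simp add: le_partition_lattice)
      have "partial_sum y 1 < k"
        using strictly_below_hook[OF k1 n g _ le] y by simp
      then have "partial_sum y j \<le> S j" for j
        using le[of j] sum_g[of 0] n by (auto simp: S_def)
      then show ?thesis using y p by (simp add: le_partition_lattice)
    qed
  qed (use gn p in auto)
qed

section \<open>Partitions of type IV and their upper covers\<close>

lemma plateau_in_partitions_of:
  assumes "t < a" "r < t" "n = a + c * t + r" "c + 2 \<le> n"
  shows "pad_zeros n (a # replicate c t @ [r]) \<in> partitions_of n"
  using assms
  by (auto simp: pad_zeros_def partitions_of_def sorted_wrt_append sorted_wrt_ge_replicate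
      sum_list_replicate)

text \<open>Capping at \<open>n\<close> accounts for the last part: since \<open>r < t\<close>, one
  more step of size \<open>t\<close> after the plateau would overshoot \<open>n\<close>.\<close>

lemma partial_sum_plateau:
  assumes "r < t" "n = a + c * t + r"
  shows "partial_sum (pad_zeros n (a # replicate c t @ [r])) (Suc j) = min (a + j * t) n"
proof (cases "j \<le> c")
  case True
  then have "j * t \<le> c * t" by simp
  with assms have "min (a + j * t) n = a + j * t" by linarith
  with True show ?thesis
    by (simp add: pad_zeros_def partial_sum_def sum_list_replicate)
next
  case False
  then have "(c + 1) * t \<le> j * t" by (intro mult_le_mono1) simp
  then have "c * t + t \<le> j * t" by simp
  with assms have "min (a + j * t) n = a + c * t + r" by linarith
  with False show ?thesis
    by (simp add: pad_zeros_def partial_sum_def sum_list_replicate take_Cons')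
qed

text \<open>The witness \<open>p\<close> is the unique upper cover \<open>(a, t + 1, t\<^sup>c\<^sup>-\<^sup>2, t - 1, r)\<close>.\<close>

lemma plateau_upper_cover:
  assumes ta: "t < a" and rt: "r < t" and c: "2 \<le> c" and n: "n = a + c * t + r" and cn: "c + 2 \<le> n"
    and m: "m = pad_zeros n (a # replicate c t @ [r])"
  obtains p where "p \<in> partitions_of n"
    "\<And>j. partial_sum p j = partial_sum m j + of_bool (j \<in> {2..c})"
    "\<And>y j. y \<in> partitions_of n \<Longrightarrow> (\<And>i. partial_sum m i \<le> partial_sum y i) \<Longrightarrow> y \<noteq> m \<Longrightarrow>
       partial_sum p j \<le> partial_sum y j"
proof -
  have mn: "m \<in> partitions_of n" using plateau_in_partitions_of[OF ta rt n cn] m by simp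
  note sum_m = partial_sum_plateau[OF rt n, folded m]
  have linear: "partial_sum m (Suc j) = a + j * t" if "j \<le> c" for j
  proof -
    have "j * t \<le> c * t" using that by simp
    then have "min (a + j * t) n = a + j * t" using n by linarith
    then show ?thesis by (simp only: sum_m)
  qed
  have last: "partial_sum m (Suc (Suc c)) = n" using rt n by (simp add: sum_m)
  define S where "S j = partial_sum m j + of_bool (j \<in> {2..c})" for j
  obtain c' where c': "c = Suc c'" using c by (cases c) auto
  obtain p where p: "p \<in> partitions_of n" "\<And>j. partial_sum p j = S j"
  proof (rule partition_with_partial_sums[of S n])
    show "S 0 = 0" by (simp add: S_def)
    show "S i \<le> S (Suc i)" for i
    \<comment> \<open>Just behind the raised block the increment drops from \<open>t\<close> to
      \<open>t - 1\<close>; elsewhere it does not decrease.\<close>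
    proof (cases "i = c")
      case True
      then show ?thesis using linear[of c] linear[of c'] c' rt by (simp add: S_def)
    next
      case False
      then show ?thesis using partial_sum_mono[of i "Suc i" m] by (simp add: S_def)
    qed
    show "S j = n" if "n \<le> j" for j
      using partial_sum_all[OF mn that] that cn by (simp add: S_def)
    show "S i + S (Suc (Suc i)) \<le> 2 * S (Suc i)" for i
    proof -
      \<comment> \<open>Only indices 1 and \<open>c + 1\<close>, adjacent to the raised block, can
        break concavity. There it amounts to \<open>t + 1 \<le> a\<close> and
        \<open>r + 1 \<le> t\<close> respectively.\<close>
      consider "i = 0" | "i = c" | "0 < i" "i \<noteq> c" by blast
      then show ?thesis
      proof cases
        case 1
        then show ?thesis using linear[of 0] linear[of 1] c ta by (simp add: S_def)
      next
        case 2
        then show ?thesis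
          using linear[of c] linear[of c'] last c' c n rt by (simp add: S_def)
      next
        case 3
        then show ?thesis using partial_sum_concave[OF mn, of i] by (auto simp: S_def)
      qed
    qed
  qed blast
  have "S j \<le> partial_sum y j"
    if y: "y \<in> partitions_of n" and le: "\<And>j. partial_sum m j \<le> partial_sum y j" and ne: "y \<noteq> m" for y j
  proof (rule ccontr)
    let ?D = "\<lambda>i. int (partial_sum y i) - int (partial_sum m i)"
    assume "\<not> S j \<le> partial_sum y j"
    then have j: "2 \<le> j" "j \<le> c" "?D j = 0"
      using le[of j] by (auto simp: S_def of_bool_def split: if_splits)
    \<comment> \<open>The sums of \<open>m\<close> are linear on the indices from 1 to
      \<open>c + 1\<close>, and the zero \<open>j\<close> is interior to that range.\<close>
    have "?D i = 0" if "1 \<le> i" "i \<le> c + 1" for i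
    proof (rule concave_nonneg_interior_zero[where p = 1 and q = "c + 1" and j = j and i = i])
      show "?D i + ?D (i + 2) \<le> 2 * ?D (i + 1)" if i: "1 \<le> i" "i + 2 \<le> c + 1" for i
      proof -
        obtain l where "i = Suc l" using i by (cases i) auto
        then show ?thesis
          using i partial_sum_concave[OF y, of i] linear[of l] linear[of "l + 1"] linear[of "l + 2"]
          by (simp add: algebra_simps)
      qed
    qed (use j that le in auto)
    \<comment> \<open>From index \<open>c + 2\<close> on \<open>m\<close> has reached the total
      \<open>n\<close>, which \<open>y\<close> cannot exceed.\<close>
    moreover have "?D i = 0" if "c + 2 \<le> i" for i
      using last partial_sum_mono[of "Suc (Suc c)" i m] that le[of i]
        partial_sum_le[OF y, of i] by simp
    ultimately have D: "?D i = 0" for i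
      by (cases "i = 0"; cases "i \<le> c + 1") auto
    have "y = m" using D by (intro partition_eqI[OF y mn]) simp
    then show False using ne by blast
  qed
  then show ?thesis using that p by (simp add: S_def)
qed

section \<open>The arrows between a hook and a partition of type IV\<close>

theorem theorem5p4:
  fixes k d t n c r :: nat and g m :: "nat list"
  assumes "1 \<le> d" and "4 \<le> k" and "2 \<le> t" and "t \<le> k - 2" and "2 * t \<le> d + 1"
    and "n = k + d"
    and "n - (k - 1) = c * t + r" and "r < t"
    and "g = pad_zeros n (k # replicate d 1)"
    and "m = pad_zeros n ((k - 1) # replicate c t @ [r])"
  shows "2 \<le> c \<and>
    g \<in> join_irreducibles (partition_lattice n) \<and> type_C n g \<and>
    m \<in> meet_irreducibles (partition_lattice n) \<and> type_IV n m \<and>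
    down_arrow (partition_lattice n) g m \<and>
    \<not> up_arrow (partition_lattice n) g m"
proof -
  let ?L = "partition_lattice n"
  interpret L: Lattice.lattice ?L by (rule lattice_partition_lattice)
  have fin: "finite (carrier ?L)" by (simp add: finite_partitions_of)
  have k: "1 \<le> k" "3 \<le> k" and ta: "t < k - 1" using assms by auto
  have n: "n = (k - 1) + c * t + r" using assms by linarith
  \<comment> \<open>Otherwise \<open>c * t + r < 2 * t \<le> d + 1\<close>, although the left side
    equals \<open>n - (k - 1) = d + 1\<close>.\<close>
  have c: "2 \<le> c"
  proof (rule ccontr)
    assume "\<not> 2 \<le> c"
    then have "c * t \<le> 1 * t" by (intro mult_le_mono1) simp
    then show False using assms by linarith
  qed
  \<comment> \<open>The list defining \<open>m\<close> has \<open>c + 2\<close> entries before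
    padding and must fit into \<open>n\<close> entries.\<close>
  have "c * 2 \<le> c * t" using \<open>2 \<le> t\<close> by simp
  then have cn: "c + 2 \<le> n" using n c \<open>4 \<le> k\<close> by linarith
  note sum_g = partial_sum_hook[OF k(1) \<open>n = k + d\<close>, folded \<open>g = _\<close>]
  note sum_m = partial_sum_plateau[OF \<open>r < t\<close> n, folded \<open>m = _\<close>]
  have gn: "g \<in> partitions_of n"
    using hook_in_partitions_of[OF k(1) \<open>n = k + d\<close>] assms(9) by simp
  have mn: "m \<in> partitions_of n"
    using plateau_in_partitions_of[OF ta \<open>r < t\<close> n cn] assms(10) by simp
  obtain p where p: "p \<in> partitions_of n"
    "\<And>j. partial_sum p j = partial_sum m j + of_bool (j \<in> {2..c})"
    and above: "\<And>y j. y \<in> partitions_of n \<Longrightarrow> (\<And>i. partial_sum m i \<le> partial_sum y i) \<Longrightarrow> y \<noteq> m \<Longrightarrow>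
       partial_sum p j \<le> partial_sum y j"
    using plateau_upper_cover[OF ta \<open>r < t\<close> c n cn \<open>m = _\<close>] by blast
  have "\<not> partial_sum p 2 \<le> partial_sum m 2" using c by (simp add: p)
  then have pm: "\<not> p \<sqsubseteq>\<^bsub>?L\<^esub> m" using p(1) mn by (auto simp: le_partition_lattice)
  have mp: "m \<sqsubseteq>\<^bsub>?L\<^esub> p" using p mn by (simp add: le_partition_lattice)
  \<comment> \<open>The raised block starts at index 2, so passing from \<open>m\<close> to
    \<open>p\<close> leaves the first part unchanged.\<close>
  have first: "partial_sum g 1 = k" "partial_sum m 1 = k - 1" "partial_sum p 1 = k - 1"
    using sum_g[of 0] sum_m[of 0] n \<open>n = k + d\<close> p(2)[of 1] by auto
  have gp: "\<not> g \<sqsubseteq>\<^bsub>?L\<^esub> p" and gm: "\<not> g \<sqsubseteq>\<^bsub>?L\<^esub> m"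
    using gn mn p(1) first k by (auto simp: le_partition_lattice intro!: exI[of _ 1])
  have "g \<in> join_irreducibles ?L"
    by (rule hook_join_irreducible[OF k(2) \<open>1 \<le> d\<close> \<open>n = k + d\<close> \<open>g = _\<close>])
  moreover have "type_C n g"
    unfolding type_C_def using gn k \<open>1 \<le> d\<close> \<open>g = _\<close> by blast
  moreover have "m \<in> meet_irreducibles ?L"
  proof (rule L.meet_irreducibleI[of m p])
    show "p \<sqsubseteq>\<^bsub>?L\<^esub> y" if "y \<in> carrier ?L" "m \<sqsubseteq>\<^bsub>?L\<^esub> y" "y \<noteq> m" for y
      using that above[of y] mn p(1) by (simp add: le_partition_lattice)
  qed (use mn p pm in auto)
  moreover have "type_IV n m"
    unfolding type_IV_def using mn ta c \<open>r < t\<close> \<open>2 \<le> t\<close> \<open>m = _\<close> by blast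
  moreover have "down_arrow ?L g m"
  proof (rule L.down_arrowI[OF fin _ gm])
    show "h \<sqsubseteq>\<^bsub>?L\<^esub> m" if h: "h \<in> carrier ?L" "h \<sqsubseteq>\<^bsub>?L\<^esub> g" "h \<noteq> g" for h
    proof -
      have le: "\<And>j. partial_sum h j \<le> partial_sum g j"
        using h gn by (simp add: le_partition_lattice)
      have h1: "partial_sum h 1 < k"
        using strictly_below_hook[OF k(1) \<open>n = k + d\<close> \<open>g = _\<close> _ le] h by simp
      have "partial_sum h j \<le> partial_sum m j" for j
      proof -
        \<comment> \<open>The sums of \<open>g\<close> exceed those of \<open>m\<close> only at
          index 1, which \<open>h1\<close> settles; elsewhere \<open>h\<close> is bounded through
          \<open>g\<close>.\<close>
        consider "j = 0" | "j = 1" | l where "j = Suc (Suc l)"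
          by (cases j rule: nat.exhaust; metis One_nat_def not0_implies_Suc)
        then show ?thesis
        proof cases
          case (3 l)
          \<comment> \<open>The first step of size \<open>t \<ge> 2\<close>, against 1 in the hook,
            already makes up for the deficit of 1 in the first part.\<close>
          have "k + Suc l \<le> k - 1 + Suc l * 2" using k by simp
          also have "\<dots> \<le> k - 1 + Suc l * t"
            using \<open>2 \<le> t\<close> by (intro add_left_mono mult_le_mono2)
          finally have "min (k + Suc l) n \<le> min (k - 1 + Suc l * t) n" by (rule min.mono) simp
          then show ?thesis using le[of j] 3 by (simp only: sum_g sum_m)
        qed (use h1 first in auto)
      qed
      then show ?thesis using h mn by (simp add: le_partition_lattice)
    qed
  qed (use gn in simp)
  moreover have "\<not> up_arrow ?L g m"
    using gn mn p(1) by (intro L.not_up_arrowI[OF fin _ _ _ mp pm gp]) auto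
  ultimately show ?thesis using c by blast
qed

end
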